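(* For all formulas $A,B,C,D$, the formula $$\big((A\circ B)\land C\big)\to\Big(\big((A\land{\sim}D)\circ B\big)\lor\big(A\circ(B\land(D\circ C))\big)\Big),$$ that is, $$\big({\sim}(A\to{\sim}B)\land C\big)\to\Big({\sim}\big((A\land{\sim}D)\to{\sim}B\big)\lor{\sim}\big(A\to{\sim}(B\land{\sim}(D\to{\sim}C))\big)\Big),$$ belongs to $\mathcal{L}_4$.
   Context: Formulas are built from a countable set of propositional variables using the binary connectives $\lor,\land,\to$ and the unary connective $\sim$. The connective $\circ$ (fusion) is defined by $A\circ B={\sim}(A\to{\sim}B)$. An assertion $A_{ij}$ is a formula $A$ together with an ordered pair of indices $i,j\in\{0,1,2,3\}$. A sequent $\Gamma\Rightarrow\Delta$ is an ordered pair of sets of assertions; commas denote union, and either side may be empty. A 4-proof is a finite sequence of sequents each of which is an Axiom or follows from one or two earlier sequents by a rule below ($\Gamma,\Gamma',\Delta,\Delta'$ are arbitrary sets of assertions, $i,j,k\in\{0,1,2,3\}$): - Axiom: $\Gamma\Rightarrow\Delta$ whenever $\Gamma\cap\Delta\neq\emptyset$. - Cut: from $\Gamma\Rightarrow\Delta,A_{ij}$ and $A_{ij},\Gamma'\Rightarrow\Delta'$ infer $\Gamma,\Gamma'\Rightarrow\Delta,\Delta'$. - Weakening: from $\Gamma\Rightarrow\Delta$ infer $\Gamma,\Gamma'\Rightarrow\Delta,\Delta'$. - $\lor|$: from $\Gamma,A_{ij}\Rightarrow\Delta$ and $\Gamma',B_{ij}\Rightarrow\Delta'$ infer $\Gamma,\Gamma',(A\lor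 B)_{ij}\Rightarrow\Delta,\Delta'$. - $|\lor$: from $\Gamma\Rightarrow\Delta,A_{ij},B_{ij}$ infer $\Gamma\Rightarrow\Delta,(A\lor B)_{ij}$. - $\land|$: from $\Gamma,A_{ij},B_{ij}\Rightarrow\Delta$ infer $\Gamma,(A\land B)_{ij}\Rightarrow\Delta$. - $|\land$: from $\Gamma\Rightarrow\Delta,A_{ij}$ and $\Gamma'\Rightarrow\Delta',B_{ij}$ infer $\Gamma,\Gamma'\Rightarrow\Delta,\Delta',(A\land B)_{ij}$. - ${\sim}|$: from $\Gamma\Rightarrow\Delta,A_{ij}$ infer $\Gamma,({\sim}A)_{ji}\Rightarrow\Delta$. - $|{\sim}$: from $\Gamma,A_{ij}\Rightarrow\Delta$ infer $\Gamma\Rightarrow\Delta,({\sim}A)_{ji}$. - ${\to}|$: from $\Gamma\Rightarrow\Delta,A_{ki}$ and $\Gamma',B_{kj}\Rightarrow\Delta'$ infer $\Gamma,\Gamma',(A\to B)_{ij}\Rightarrow\Delta,\Delta'$. - $|{\to}$: from $\Gamma,A_{ki}\Rightarrow\Delta,B_{kj}$ infer $\Gamma\Rightarrow\Delta,(A\to B)_{ij}$, provided $k\neq i,j$ and $k$ does not occur as a subscript in any assertion of $\Gamma\cup\Delta$. Tarski's relevance logic $\mathcal{L}_4$ is the set of formulas $A$ such that the sequent $\Rightarrow A_{00}$ appears in some 4-proof. *)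

theory Defs
  imports Main
begin

datatype form =
    Var nat
  | Or form form  (infixr "\<^bold>\<or>" 65)
  | And form form  (infixr "\<^bold>\<and>" 70)
  | Imp form form  (infixr "\<^bold>\<rightarrow>" 60)
  | Neg form  ("\<^bold>\<sim> _" [80] 80)

abbreviation Fusion :: "form \<Rightarrow> form \<Rightarrow> form"  (infixl "\<^bold>\<circ>" 75) where
  "A \<^bold>\<circ> B \<equiv> \<^bold>\<sim> (A \<^bold>\<rightarrow> \<^bold>\<sim> B)"

text \<open>The constructors stand for the indices 0, 1, 2, 3.\<close>

datatype index = I0 | I1 | I2 | I3

datatype assertion = Asn form index index

fun subscripts :: "assertion \<Rightarrow> index set" where
  "subscripts (Asn A i j) = {i, j}"

text \<open>The sets of assertions in a sequent are arbitrary; in particular they may be infinite.\<close>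

datatype sequent = Sequent "assertion set" "assertion set"  (infix "\<turnstile>" 45)

text \<open>\<open>rule Ps S\<close>: the sequent \<open>S\<close> follows in one step from the premises \<open>Ps\<close>;
  axioms are the rules without premises. The suffixes \<open>L\<close> and \<open>R\<close> mark the side of the sequent
  on which the connective is introduced. Since \<open>insert\<close> is union with a singleton, a context
  may already contain the displayed assertions.\<close>

inductive rule :: "sequent list \<Rightarrow> sequent \<Rightarrow> bool" where
  Axiom: "\<Gamma> \<inter> \<Delta> \<noteq> {} \<Longrightarrow> rule [] (\<Gamma> \<turnstile> \<Delta>)"
| Cut: "rule [\<Gamma> \<turnstile> insert (Asn A i j) \<Delta>, insert (Asn A i j) \<Gamma>' \<turnstile> \<Delta>'] (\<Gamma> \<union> \<Gamma>' \<turnstile> \<Delta> \<union> \<Delta>')"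
| Weakening: "rule [\<Gamma> \<turnstile> \<Delta>] (\<Gamma> \<union> \<Gamma>' \<turnstile> \<Delta> \<union> \<Delta>')"
| OrL: "rule [insert (Asn A i j) \<Gamma> \<turnstile> \<Delta>, insert (Asn B i j) \<Gamma>' \<turnstile> \<Delta>']
    (insert (Asn (A \<^bold>\<or> B) i j) (\<Gamma> \<union> \<Gamma>') \<turnstile> \<Delta> \<union> \<Delta>')"
| OrR: "rule [\<Gamma> \<turnstile> insert (Asn A i j) (insert (Asn B i j) \<Delta>)]
    (\<Gamma> \<turnstile> insert (Asn (A \<^bold>\<or> B) i j) \<Delta>)"
| AndL: "rule [insert (Asn A i j) (insert (Asn B i j) \<Gamma>) \<turnstile> \<Delta>]
    (insert (Asn (A \<^bold>\<and> B) i j) \<Gamma> \<turnstile> \<Delta>)"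
| AndR: "rule [\<Gamma> \<turnstile> insert (Asn A i j) \<Delta>, \<Gamma>' \<turnstile> insert (Asn B i j) \<Delta>']
    (\<Gamma> \<union> \<Gamma>' \<turnstile> insert (Asn (A \<^bold>\<and> B) i j) (\<Delta> \<union> \<Delta>'))"
| NegL: "rule [\<Gamma> \<turnstile> insert (Asn A i j) \<Delta>] (insert (Asn (\<^bold>\<sim> A) j i) \<Gamma> \<turnstile> \<Delta>)"
| NegR: "rule [insert (Asn A i j) \<Gamma> \<turnstile> \<Delta>] (\<Gamma> \<turnstile> insert (Asn (\<^bold>\<sim> A) j i) \<Delta>)"
| ImpL: "rule [\<Gamma> \<turnstile> insert (Asn A k i) \<Delta>, insert (Asn B k j) \<Gamma>' \<turnstile> \<Delta>']
    (insert (Asn (A \<^bold>\<rightarrow> B) i j) (\<Gamma> \<union> \<Gamma>') \<turnstile> \<Delta> \<union> \<Delta>')"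
| ImpR: "k \<noteq> i \<Longrightarrow> k \<noteq> j \<Longrightarrow> (\<And>a. a \<in> \<Gamma> \<union> \<Delta> \<Longrightarrow> k \<notin> subscripts a) \<Longrightarrow>
    rule [insert (Asn A k i) \<Gamma> \<turnstile> insert (Asn B k j) \<Delta>]
      (\<Gamma> \<turnstile> insert (Asn (A \<^bold>\<rightarrow> B) i j) \<Delta>)"

definition four_proof :: "sequent list \<Rightarrow> bool" where
  "four_proof \<pi> \<longleftrightarrow>
    (\<forall>n < length \<pi>. \<exists>Ps. set Ps \<subseteq> set (take n \<pi>) \<and> rule Ps (\<pi> ! n))"

definition L4 :: "form set" where
  "L4 = {A. \<exists>\<pi>. four_proof \<pi> \<and> ({} \<turnstile> {Asn A I0 I0}) \<in> set \<pi>}"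

end

theory Submission
  imports Defs
begin

text \<open>
  Read \<open>A\<^sub>i\<^sub>j\<close> as ``\<open>i\<close> and \<open>j\<close> are related by \<open>A\<close>''. The rules then make \<open>\<^bold>\<sim> A\<close> the converse of the
  complement of \<open>A\<close>, and \<open>A \<^bold>\<rightarrow> B\<close> a residual of relation composition, so that
  \<open>(A \<^bold>\<circ> B)\<^sub>i\<^sub>j\<close> holds iff some \<open>k\<close> satisfies \<open>B\<^sub>i\<^sub>k\<close> and \<open>A\<^sub>k\<^sub>j\<close>. The lemmas \<open>provable_FusionL\<close> and
  \<open>provable_FusionR\<close> are the two halves of this equivalence.

  Under this reading the theorem has a three-point argument. Suppose that \<open>(A \<^bold>\<circ> B) \<^bold>\<and> C\<close> holds at
  \<open>(1,0)\<close>. Then \<open>C\<^sub>1\<^sub>0\<close>, and there is a point \<open>2\<close> with \<open>B\<^sub>1\<^sub>2\<close> and \<open>A\<^sub>2\<^sub>0\<close>. If \<open>D\<^sub>0\<^sub>2\<close> fails, then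
  \<open>(\<^bold>\<sim> D)\<^sub>2\<^sub>0\<close> holds, so the point \<open>2\<close> witnesses the first disjunct at \<open>(1,0)\<close>. If \<open>D\<^sub>0\<^sub>2\<close> holds, then
  the path \<open>C\<^sub>1\<^sub>0\<close>, \<open>D\<^sub>0\<^sub>2\<close> closes a triangle and gives \<open>(D \<^bold>\<circ> C)\<^sub>1\<^sub>2\<close>, so the point \<open>2\<close> witnesses the
  second disjunct. In the sequent calculus the case distinction on \<open>D\<^sub>0\<^sub>2\<close> becomes an application of
  the right rule for \<open>\<^bold>\<sim>\<close> while both disjuncts are kept on the right.
\<close>

definition provable :: "sequent \<Rightarrow> bool" where
  "provable S \<longleftrightarrow> (\<exists>\<pi>. four_proof \<pi> \<and> S \<in> set \<pi>)"

lemma four_proof_Nil: "four_proof []"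
  by (simp add: four_proof_def)

lemma four_proof_append:
  assumes "four_proof \<pi>" and "four_proof \<rho>"
  shows "four_proof (\<pi> @ \<rho>)"
  unfolding four_proof_def
proof (intro allI impI)
  fix n assume n: "n < length (\<pi> @ \<rho>)"
  show "\<exists>Ps. set Ps \<subseteq> set (take n (\<pi> @ \<rho>)) \<and> rule Ps ((\<pi> @ \<rho>) ! n)"
  proof (cases "n < length \<pi>")
    case True
    then show ?thesis
      using assms(1) by (simp add: four_proof_def nth_append)
  next
    case False
    then have "n - length \<pi> < length \<rho>"
      using n by auto
    then obtain Ps where "set Ps \<subseteq> set (take (n - length \<pi>) \<rho>)" "rule Ps (\<rho> ! (n - length \<pi>))"
      using assms(2) by (auto simp: four_proof_def)
    then show ?thesis
      using False by (intro exI[of _ Ps]) (auto simp: nth_append)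
  qed
qed

lemma four_proof_snoc:
  assumes "four_proof \<pi>" and "set Ps \<subseteq> set \<pi>" and "rule Ps S"
  shows "four_proof (\<pi> @ [S])"
  using assms by (auto simp: four_proof_def nth_append less_Suc_eq)

lemma common_four_proof:
  assumes "\<forall>P \<in> set Ps. provable P"
  shows "\<exists>\<pi>. four_proof \<pi> \<and> set Ps \<subseteq> set \<pi>"
  using assms
proof (induction Ps)
  case Nil
  then show ?case
    using four_proof_Nil by auto
next
  case (Cons P Ps)
  then obtain \<pi> \<rho> where "four_proof \<pi>" "P \<in> set \<pi>" "four_proof \<rho>" "set Ps \<subseteq> set \<rho>"
    by (auto simp: provable_def)
  then show ?case
    by (intro exI[of _ "\<pi> @ \<rho>"]) (auto simp: four_proof_append)
qed

text \<open>Proofs of the premises can be concatenated into one list. Hence provability is closed under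
  the rules, and derivations can be built as trees without regard to positions in a list.\<close>

lemma provable_rule:
  assumes "rule Ps S" and "\<forall>P \<in> set Ps. provable P"
  shows "provable S"
proof -
  obtain \<pi> where "four_proof \<pi>" "set Ps \<subseteq> set \<pi>"
    using common_four_proof[OF assms(2)] by blast
  then have "four_proof (\<pi> @ [S])"
    using four_proof_snoc assms(1) by blast
  then show ?thesis
    unfolding provable_def by (intro exI[of _ "\<pi> @ [S]"]) simp
qed

lemma provable_Axiom:
  assumes "a \<in> \<Gamma>" and "a \<in> \<Delta>"
  shows "provable (\<Gamma> \<turnstile> \<Delta>)"
  using assms by (intro provable_rule[OF rule.Axiom]) auto

lemma provable_OrR:
  assumes "provable (\<Gamma> \<turnstile> insert (Asn A i j) (insert (Asn B i j) \<Delta>))"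
  shows "provable (\<Gamma> \<turnstile> insert (Asn (A \<^bold>\<or> B) i j) \<Delta>)"
  using assms by (intro provable_rule[OF rule.OrR]) simp

lemma provable_AndL:
  assumes "provable (insert (Asn A i j) (insert (Asn B i j) \<Gamma>) \<turnstile> \<Delta>)"
  shows "provable (insert (Asn (A \<^bold>\<and> B) i j) \<Gamma> \<turnstile> \<Delta>)"
  using assms by (intro provable_rule[OF rule.AndL]) simp

lemma provable_AndR:
  assumes "provable (\<Gamma> \<turnstile> insert (Asn A i j) \<Delta>)" and "provable (\<Gamma> \<turnstile> insert (Asn B i j) \<Delta>)"
  shows "provable (\<Gamma> \<turnstile> insert (Asn (A \<^bold>\<and> B) i j) \<Delta>)"
  using provable_rule[OF rule.AndR[of \<Gamma> A i j \<Delta> \<Gamma> B \<Delta>]] assms by simp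

lemma provable_NegL:
  assumes "provable (\<Gamma> \<turnstile> insert (Asn A i j) \<Delta>)"
  shows "provable (insert (Asn (\<^bold>\<sim> A) j i) \<Gamma> \<turnstile> \<Delta>)"
  using assms by (intro provable_rule[OF rule.NegL]) simp

lemma provable_NegR:
  assumes "provable (insert (Asn A i j) \<Gamma> \<turnstile> \<Delta>)"
  shows "provable (\<Gamma> \<turnstile> insert (Asn (\<^bold>\<sim> A) j i) \<Delta>)"
  using assms by (intro provable_rule[OF rule.NegR]) simp

lemma provable_ImpL:
  assumes "provable (\<Gamma> \<turnstile> insert (Asn A k i) \<Delta>)" and "provable (insert (Asn B k j) \<Gamma> \<turnstile> \<Delta>)"
  shows "provable (insert (Asn (A \<^bold>\<rightarrow> B) i j) \<Gamma> \<turnstile> \<Delta>)"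
  using provable_rule[OF rule.ImpL[of \<Gamma> A k i \<Delta> B j \<Gamma> \<Delta>]] assms by simp

lemma provable_ImpR:
  assumes "provable (insert (Asn A k i) \<Gamma> \<turnstile> insert (Asn B k j) \<Delta>)"
    and "k \<noteq> i" and "k \<noteq> j" and "\<forall>a \<in> \<Gamma> \<union> \<Delta>. k \<notin> subscripts a"
  shows "provable (\<Gamma> \<turnstile> insert (Asn (A \<^bold>\<rightarrow> B) i j) \<Delta>)"
  using assms by (intro provable_rule[OF rule.ImpR[of k i j \<Gamma> \<Delta> A B]]) auto

text \<open>Fusion behaves as an existential quantifier over an intermediate index: on the left the
  index is an eigenvariable, on the right it is a witness of choice. Each \<open>\<^bold>\<sim>\<close> in
  \<open>\<^bold>\<sim> (A \<^bold>\<rightarrow> \<^bold>\<sim> B)\<close> swaps both the sides of the sequent and the indices, so the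
  right rule for \<open>\<^bold>\<rightarrow>\<close> yields the left rule for \<open>\<^bold>\<circ>\<close> and conversely.\<close>

lemma provable_FusionL:
  assumes "provable (insert (Asn B i k) (insert (Asn A k j) \<Gamma>) \<turnstile> \<Delta>)"
    and "k \<noteq> i" and "k \<noteq> j" and "\<forall>a \<in> \<Gamma> \<union> \<Delta>. k \<notin> subscripts a"
  shows "provable (insert (Asn (A \<^bold>\<circ> B) i j) \<Gamma> \<turnstile> \<Delta>)"
  using assms by (intro provable_NegL provable_ImpR[of A k j \<Gamma>] provable_NegR) auto

lemma provable_FusionR:
  assumes "provable (\<Gamma> \<turnstile> insert (Asn B i k) \<Delta>)" and "provable (\<Gamma> \<turnstile> insert (Asn A k j) \<Delta>)"
  shows "provable (\<Gamma> \<turnstile> insert (Asn (A \<^bold>\<circ> B) i j) \<Delta>)"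
  using assms by (intro provable_NegR provable_ImpL[of \<Gamma> A k j] provable_NegL)

theorem lemma32:
  fixes A B C D :: form
  shows "(((A \<^bold>\<circ> B) \<^bold>\<and> C) \<^bold>\<rightarrow>
      (((A \<^bold>\<and> \<^bold>\<sim> D) \<^bold>\<circ> B) \<^bold>\<or> (A \<^bold>\<circ> (B \<^bold>\<and> (D \<^bold>\<circ> C))))) \<in> L4"
proof -
  let ?X = "(A \<^bold>\<and> \<^bold>\<sim> D) \<^bold>\<circ> B"
  let ?Y = "A \<^bold>\<circ> (B \<^bold>\<and> (D \<^bold>\<circ> C))"
  let ?\<Gamma> = "{Asn B I1 I2, Asn A I2 I0, Asn C I1 I0}"
  have "provable (insert (Asn D I0 I2) ?\<Gamma> \<turnstile> {Asn (D \<^bold>\<circ> C) I1 I2})"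
    by (rule provable_FusionR[where k = I0]; rule provable_Axiom) auto
  then have "provable (insert (Asn D I0 I2) ?\<Gamma> \<turnstile> {Asn (B \<^bold>\<and> (D \<^bold>\<circ> C)) I1 I2})"
    by (rule provable_AndR[rotated]) (auto intro: provable_Axiom)
  then have "provable (insert (Asn D I0 I2) ?\<Gamma> \<turnstile> {Asn ?Y I1 I0})"
    by (rule provable_FusionR) (auto intro: provable_Axiom)
  \<comment> \<open>The case distinction on \<open>D\<^sub>0\<^sub>2\<close>: its failure, \<open>(\<^bold>\<sim> D)\<^sub>2\<^sub>0\<close>, becomes an alternative to \<open>?Y\<close>.\<close>
  then have "provable (?\<Gamma> \<turnstile> {Asn (\<^bold>\<sim> D) I2 I0, Asn ?Y I1 I0})"
    by (rule provable_NegR)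
  then have "provable (?\<Gamma> \<turnstile> {Asn (A \<^bold>\<and> \<^bold>\<sim> D) I2 I0, Asn ?Y I1 I0})"
    by (rule provable_AndR[rotated]) (auto intro: provable_Axiom)
  then have "provable (?\<Gamma> \<turnstile> {Asn ?X I1 I0, Asn ?Y I1 I0})"
    by (rule provable_FusionR[rotated]) (auto intro: provable_Axiom)
  then have "provable (?\<Gamma> \<turnstile> {Asn (?X \<^bold>\<or> ?Y) I1 I0})"
    by (rule provable_OrR)
  \<comment> \<open>With both disjuncts folded up again at \<open>(1,0)\<close>, the index \<open>2\<close> is fresh.\<close>
  then have "provable ({Asn (A \<^bold>\<circ> B) I1 I0, Asn C I1 I0} \<turnstile> {Asn (?X \<^bold>\<or> ?Y) I1 I0})"
    by (rule provable_FusionL) auto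
  then have "provable ({Asn ((A \<^bold>\<circ> B) \<^bold>\<and> C) I1 I0} \<turnstile> {Asn (?X \<^bold>\<or> ?Y) I1 I0})"
    by (rule provable_AndL)
  then have "provable ({} \<turnstile> {Asn (((A \<^bold>\<circ> B) \<^bold>\<and> C) \<^bold>\<rightarrow> (?X \<^bold>\<or> ?Y)) I0 I0})"
    by (rule provable_ImpR) auto
  then show ?thesis
    by (simp add: L4_def provable_def)
qed

end
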